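(* Let $M$ be a free $\mathbb{Z}$-module of rank $n\ge 1$, $M_{\mathbb{R}}=M\otimes_{\mathbb{Z}}\mathbb{R}\cong\mathbb{R}^n$, and let $P\subseteq M_{\mathbb{R}}$ be an $n$-dimensional lattice simplex. If its lattice length satisfies $L(P)\ge n-1$, then $P$ is integrally closed, i.e. $(P\cap M)+((rP)\cap M)=((r+1)P)\cap M$ for every positive integer $r$.
   Context: A lattice polytope in $M_{\mathbb{R}}$ is the convex hull of a finite subset of $M$; all polytopes are assumed full-dimensional. A lattice simplex is a full-dimensional lattice polytope with exactly $n+1$ vertices. $A+B=\{a+b : a\in A,\ b\in B\}$ denotes the Minkowski sum and $rP=\{ru : u\in P\}$. For two distinct vertices $u_i,u_j$ of $P$ with joining segment $e_{ij}$, the lattice length of $e_{ij}$ is $l_{ij}=\#(e_{ij}\cap M)-1$. The lattice length $L(P)$ of $P$ is the minimum of $l_{ij}$ over all edges $e_{ij}$ of $P$. *)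

theory Defs
  imports "HOL-Analysis.Analysis" "HOL-Library.Set_Algebras"
begin

text \<open>
  A free \<open>\<int>\<close>-module \<open>M\<close> of rank \<open>n\<close> inside \<open>M \<otimes> \<real>\<close> is the set of integer combinations of a
  real basis. The ambient space is an arbitrary Euclidean space of dimension \<open>n = DIM('a) \<ge> 1\<close>;
  its inner product plays no role.
\<close>

definition full_lattice :: "'a::euclidean_space set \<Rightarrow> bool" where
  "full_lattice M \<longleftrightarrow>
     (\<exists>B. independent B \<and> span B = UNIV \<and>
          M = range (\<lambda>c :: 'a \<Rightarrow> int. \<Sum>b\<in>B. of_int (c b) *\<^sub>R b))"

definition vertices :: "'a::euclidean_space set \<Rightarrow> 'a set" where
  "vertices P = {v. v extreme_point_of P}"

definition lattice_polytope :: "'a::euclidean_space set \<Rightarrow> 'a set \<Rightarrow> bool" where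
  "lattice_polytope M P \<longleftrightarrow>
     (\<exists>S. finite S \<and> S \<subseteq> M \<and> P = convex hull S) \<and> aff_dim P = int DIM('a)"

definition lattice_simplex :: "'a::euclidean_space set \<Rightarrow> 'a set \<Rightarrow> bool" where
  "lattice_simplex M P \<longleftrightarrow> lattice_polytope M P \<and> card (vertices P) = DIM('a) + 1"

text \<open>
  For \<open>u, v \<in> M\<close> the set counted here is finite and contains \<open>u\<close>, so neither the cardinality
  nor the subtraction degenerates.
\<close>

definition segment_lattice_length :: "'a::euclidean_space set \<Rightarrow> 'a \<Rightarrow> 'a \<Rightarrow> nat" where
  "segment_lattice_length M u v = card (closed_segment u v \<inter> M) - 1"

text \<open>A full-dimensional polytope has at least one edge and only finitely many, as \<open>DIM('a) \<ge> 1\<close>.\<close>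

definition lattice_length :: "'a::euclidean_space set \<Rightarrow> 'a set \<Rightarrow> nat" where
  "lattice_length M P =
     Min {segment_lattice_length M u v | u v.
            u \<in> vertices P \<and> v \<in> vertices P \<and> u \<noteq> v \<and> closed_segment u v edge_of P}"

definition dilate :: "nat \<Rightarrow> 'a::euclidean_space set \<Rightarrow> 'a set" where
  "dilate r P = (\<lambda>u. real r *\<^sub>R u) ` P"

definition integrally_closed :: "'a::euclidean_space set \<Rightarrow> 'a set \<Rightarrow> bool" where
  "integrally_closed M P \<longleftrightarrow>
     (\<forall>r\<ge>1. (P \<inter> M) + (dilate r P \<inter> M) = dilate (r + 1) P \<inter> M)"

end

theory Submission
  imports Defs
begin

text \<open>
  Let \<open>n = DIM('a)\<close>. One inclusion is convexity; for the other, a lattice point \<open>x\<close> of \<open>d P\<close>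
  with \<open>d \<ge> 2\<close> must be written as a lattice point of \<open>P\<close> plus a point of \<open>(d - 1) P\<close>.

  The engine is the classical fact \<open>split_off_lattice_point\<close>: this decomposition exists in every
  lattice polytope as soon as \<open>d \<ge> n\<close>. In the situation at hand it settles \<open>n \<le> 2\<close> and
  leaves the degrees \<open>d\<close> below \<open>n\<close>, which is where the long edges enter.

  Suppose \<open>n \<ge> 3\<close> and write \<open>x\<close> as the combination of the vertices \<open>v\<close> with coefficients
  \<open>t v \<ge> 0\<close> of sum \<open>d\<close>. Some vertex \<open>p\<close> has
  \<open>t p \<ge> d / (n + 1) \<ge> 2 / (n + 1) \<ge> 1 / (n - 1)\<close>.
  An edge of lattice length at least \<open>n - 1\<close> contains a lattice vector of at most \<open>1 / (n - 1)\<close>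
  of its length (\<open>lattice_step_on_segment\<close>). These short vectors, taken along the edges at \<open>p\<close>,
  span together with \<open>p\<close> a small lattice simplex \<open>Q\<close> in the corner of \<open>P\<close> at \<open>p\<close>.
  Now walk from \<open>p\<close> through lattice points of \<open>P\<close>, keeping the barycentric coordinate at each
  vertex \<open>v\<close> other than \<open>p\<close> at most \<open>t v\<close>, until the coordinate at \<open>p\<close> has
  decreased from \<open>1\<close> to at most \<open>t p\<close>; the point then reached can be split off from \<open>x\<close>.
  A walk that has not arrived can be continued: what is still available, measured in multiples of
  \<open>Q\<close>, has degree above \<open>n - 1\<close>, so the classical fact, applied to \<open>Q\<close>, supplies a step.
  No step can leave \<open>P\<close>: as \<open>Q\<close> is small, it lowers the coordinate at \<open>p\<close>
  by at most \<open>1 / (n - 1) \<le> t p\<close>, and this coordinate was still larger than \<open>t p\<close>.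
  The walk is \<open>corner_lattice_point\<close>, and \<open>split_off_long_simplex\<close> carries it over to \<open>P\<close>.
\<close>

section \<open>Full lattices\<close>

lemma full_lattice_zero:
  assumes "full_lattice M"
  shows "0 \<in> M"
proof -
  obtain B where M: "M = range (\<lambda>c :: 'a \<Rightarrow> int. \<Sum>b\<in>B. of_int (c b) *\<^sub>R b)"
    using assms by (auto simp: full_lattice_def)
  show ?thesis
    unfolding M by (rule image_eqI[where x = "\<lambda>_. 0"]) simp_all
qed

lemma full_lattice_diff:
  assumes "full_lattice M" "x \<in> M" "y \<in> M"
  shows "x - y \<in> M"
proof -
  obtain B where M: "M = range (\<lambda>c :: 'a \<Rightarrow> int. \<Sum>b\<in>B. of_int (c b) *\<^sub>R b)"
    using assms(1) by (auto simp: full_lattice_def)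
  obtain c c' where "x = (\<Sum>b\<in>B. of_int (c b) *\<^sub>R b)" "y = (\<Sum>b\<in>B. of_int (c' b) *\<^sub>R b)"
    using assms(2,3) M by blast
  then have "x - y = (\<Sum>b\<in>B. of_int (c b - c' b) *\<^sub>R b)"
    by (simp add: sum_subtractf scaleR_diff_left)
  then show ?thesis
    using M by (auto intro!: image_eqI[where x = "\<lambda>b. c b - c' b"])
qed

lemma full_lattice_add:
  assumes "full_lattice M" "x \<in> M" "y \<in> M"
  shows "x + y \<in> M"
  using full_lattice_diff[OF assms(1,2) full_lattice_diff[OF assms(1) full_lattice_zero assms(3)]]
    assms(1) by simp

lemma full_lattice_sum:
  assumes "full_lattice M" "\<And>i. i \<in> I \<Longrightarrow> f i \<in> M"
  shows "sum f I \<in> M"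
  using assms(2)
  by (induction I rule: infinite_finite_induct)
    (auto simp: full_lattice_zero full_lattice_add assms(1))

lemma representation_sum_scaleR:
  fixes B :: "'a::euclidean_space set"
  assumes "independent B" "b \<in> B"
  shows "representation B (\<Sum>b\<in>B. u b *\<^sub>R b) b = u b"
proof -
  have "representation B (\<Sum>b\<in>B. u b *\<^sub>R b) b = (\<Sum>b'\<in>B. u b' * representation B b' b)"
    using assms by (simp add: representation_sum representation_scale span_scale span_base)
  also have "\<dots> = (\<Sum>b'\<in>B. if b' = b then u b' else 0)"
    using assms(1) by (intro sum.cong) (auto simp: representation_basis)
  also have "\<dots> = u b"
    using assms(2) independent_imp_finite[OF assms(1)] by simp
  finally show ?thesis .
qed

text \<open>
  The coordinates with respect to a lattice basis are linear functionals, hence bounded on bounded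
  sets, which leaves finitely many integer values for each.
\<close>

lemma full_lattice_finite_bounded:
  fixes M :: "'a::euclidean_space set"
  assumes "full_lattice M" "bounded K"
  shows "finite (K \<inter> M)"
proof -
  obtain B where B: "independent B" "span B = UNIV"
    and M: "M = range (\<lambda>c :: 'a \<Rightarrow> int. \<Sum>b\<in>B. of_int (c b) *\<^sub>R b)"
    using assms(1) by (auto simp: full_lattice_def)
  have finB: "finite B"
    using B(1) by (rule independent_imp_finite)
  define coord where "coord = (\<lambda>b v. representation B v b)"
  have coord: "coord b (\<Sum>b\<in>B. u b *\<^sub>R b) = u b" if "b \<in> B" for u b
    using representation_sum_scaleR[OF B(1) that] by (simp add: coord_def)
  have "\<exists>N. \<forall>v\<in>K. \<bar>coord b v\<bar> \<le> N" for b
  proof -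
    have "linear (coord b)"
      using B by (auto simp: coord_def linear_iff representation_add representation_scale)
    then have "bounded (coord b ` K)"
      using assms(2) bounded_linear_image linear_conv_bounded_linear by blast
    then show ?thesis
      by (auto simp: bounded_iff)
  qed
  then obtain N where N: "\<And>b v. v \<in> K \<Longrightarrow> \<bar>coord b v\<bar> \<le> N b"
    by metis
  define C where "C = (\<Pi>\<^sub>E b\<in>B. {- \<lceil>N b\<rceil> .. \<lceil>N b\<rceil>})"
  have "finite C"
    unfolding C_def using finB by (intro finite_PiE) auto
  moreover have "K \<inter> M \<subseteq> (\<lambda>c. \<Sum>b\<in>B. of_int (c b) *\<^sub>R b) ` C"
  proof
    fix v
    assume v: "v \<in> K \<inter> M"
    then obtain c :: "'a \<Rightarrow> int" where c: "v = (\<Sum>b\<in>B. of_int (c b) *\<^sub>R b)"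
      using M by blast
    have "restrict c B \<in> C"
      unfolding C_def
    proof (rule restrict_PiE_iff[THEN iffD2], rule ballI)
      fix b
      assume "b \<in> B"
      then have "\<bar>of_int (c b)\<bar> \<le> N b"
        using N[of v b] v coord[of b "\<lambda>b. of_int (c b)"] c by auto
      then show "c b \<in> {- \<lceil>N b\<rceil> .. \<lceil>N b\<rceil>}"
        by (simp add: abs_le_iff) linarith
    qed
    moreover have "v = (\<Sum>b\<in>B. of_int (restrict c B b) *\<^sub>R b)"
      by (simp add: c)
    ultimately show "v \<in> (\<lambda>c. \<Sum>b\<in>B. of_int (c b) *\<^sub>R b) ` C"
      by blast
  qed
  ultimately show ?thesis
    by (meson finite_imageI finite_subset)
qed

section \<open>Dilated convex hulls\<close>

text \<open>
  For \<open>d = 0\<close> the dilate is \<open>{0}\<close>, in agreement with the right-hand side; an empty \<open>S\<close> would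
  break this case.
\<close>

lemma dilate_convex_hull_iff:
  assumes "finite S" "S \<noteq> {}"
  shows "x \<in> dilate d (convex hull S) \<longleftrightarrow>
    (\<exists>t. (\<forall>v\<in>S. 0 \<le> t v) \<and> sum t S = real d \<and> x = (\<Sum>v\<in>S. t v *\<^sub>R v))"
    (is "_ \<longleftrightarrow> ?R")
proof
  assume "x \<in> dilate d (convex hull S)"
  then obtain u where u: "\<forall>v\<in>S. 0 \<le> u v" "sum u S = 1" "x = real d *\<^sub>R (\<Sum>v\<in>S. u v *\<^sub>R v)"
    using assms(1) by (auto simp: dilate_def convex_hull_finite)
  then show ?R
    by (intro exI[of _ "\<lambda>v. real d * u v"])
      (auto simp: scaleR_sum_right sum_distrib_left[symmetric])
next
  assume ?R
  then obtain t where t: "\<forall>v\<in>S. 0 \<le> t v" "sum t S = real d" "x = (\<Sum>v\<in>S. t v *\<^sub>R v)"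
    by blast
  show "x \<in> dilate d (convex hull S)"
  proof (cases "d = 0")
    case True
    then have "\<forall>v\<in>S. t v = 0"
      using t assms(1) by (simp add: sum_nonneg_eq_0_iff)
    then have "x = 0"
      using t(3) by simp
    moreover obtain w where "w \<in> S"
      using assms(2) by blast
    ultimately show ?thesis
      using True by (auto simp: dilate_def image_iff intro!: bexI[of _ w] hull_inc)
  next
    case False
    have "(\<Sum>v\<in>S. (t v / real d) *\<^sub>R v) \<in> convex hull S"
      using t False assms(1)
      by (intro convex_sum) (auto simp: sum_divide_distrib[symmetric] hull_inc)
    moreover have "x = real d *\<^sub>R (\<Sum>v\<in>S. (t v / real d) *\<^sub>R v)"
      using t False by (simp add: scaleR_sum_right)
    ultimately show ?thesis
      unfolding dilate_def by blast
  qed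
qed

lemma dilate_mono: "A \<subseteq> B \<Longrightarrow> dilate d A \<subseteq> dilate d B"
  by (auto simp: dilate_def)

lemma dilate_add_convex:
  assumes "convex P" "x \<in> P" "y \<in> dilate r P"
  shows "x + y \<in> dilate (r + 1) P"
proof -
  obtain z where z: "z \<in> P" "y = real r *\<^sub>R z"
    using assms(3) by (auto simp: dilate_def)
  have "(1 / (real r + 1)) *\<^sub>R x + (real r / (real r + 1)) *\<^sub>R z \<in> P"
    using assms z by (intro convexD) (auto simp: field_simps)
  moreover have "x + y = real (r + 1) *\<^sub>R
      ((1 / (real r + 1)) *\<^sub>R x + (real r / (real r + 1)) *\<^sub>R z)"
    using z by (simp add: scaleR_right_distrib add.commute)
  ultimately show ?thesis
    unfolding dilate_def by blast
qed

text \<open>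
  Among the finite subsets of \<open>W\<close> whose hull contains \<open>x\<close>, one of least cardinality cannot be
  affinely dependent, since Caratheodory's theorem would shrink it further.
\<close>

lemma caratheodory_affine_independent:
  fixes x :: "'a::euclidean_space"
  assumes "x \<in> convex hull W"
  obtains U where "U \<subseteq> W" "\<not> affine_dependent U" "x \<in> convex hull U"
proof -
  define ok where "ok U \<longleftrightarrow> finite U \<and> U \<subseteq> W \<and> x \<in> convex hull U" for U
  obtain U0 where "ok U0"
    using assms unfolding ok_def caratheodory[of W] by blast
  then obtain U where U: "ok U" and min: "\<And>V. ok V \<Longrightarrow> card U \<le> card V"
    using ex_has_least_nat[of ok U0 card] by blast
  obtain V where "finite V" "V \<subseteq> U" "int (card V) \<le> aff_dim U + 1" "x \<in> convex hull V"
    using U caratheodory_aff_dim[of U] unfolding ok_def by blast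
  moreover from this have "card U \<le> card V"
    using U by (intro min) (auto simp: ok_def)
  ultimately have "int (card U) \<le> aff_dim U + 1"
    by linarith
  then have "\<not> affine_dependent U"
    using U aff_dim_le_card[of U] by (auto simp: ok_def affine_independent_iff_card)
  then show ?thesis
    using U that unfolding ok_def by blast
qed

section \<open>Splitting off a lattice point\<close>

text \<open>
  Write \<open>x\<close> as a nonnegative combination, with coefficients \<open>t w\<close> of sum \<open>d\<close>, of the vertices
  of a lattice simplex inside the polytope. A vertex with \<open>t w \<ge> 1\<close> can be split off. If there
  is none, then \<open>d \<ge> DIM('a)\<close> forces exactly \<open>d + 1\<close> vertices, and the complementary point with
  coefficients \<open>1 - t w > 0\<close> has degree one: it is a lattice point of the simplex and is no
  vertex. Exchanging a vertex for it (and dropping superfluous ones, by Caratheodory's theorem)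
  gives a simplex with fewer lattice points whose dilate still contains \<open>x\<close>, so a simplex with the least number of lattice points cannot be in
  this second case.
\<close>

lemma split_off_lattice_point:
  fixes M :: "'a::euclidean_space set"
  assumes M: "full_lattice M" and S: "finite S" "S \<subseteq> M"
    and x: "x \<in> M" "x \<in> dilate d (convex hull S)" and d: "DIM('a) \<le> d"
  obtains h where "h \<in> convex hull S" "h \<in> M" "x - h \<in> dilate (d - 1) (convex hull S)"
proof -
  define Q where "Q = convex hull S"
  have "bounded Q"
    unfolding Q_def using S(1) by (simp add: bounded_convex_hull finite_imp_bounded)
  then have finQ: "finite (Q \<inter> M)"
    using M by (rule full_lattice_finite_bounded[rotated])
  have d_pos: "d \<ge> 1"
    using d DIM_positive[where 'a = 'a] by linarith
  define ok where "ok W \<longleftrightarrow> W \<subseteq> Q \<inter> M \<and> \<not> affine_dependent W \<and> x \<in> dilate d (convex hull W)" for W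
  have hull_sub: "convex hull W \<subseteq> Q" if "W \<subseteq> Q" for W
    using that by (simp add: Q_def hull_minimal)
  have refine: "\<exists>U\<subseteq>W. ok U" if W: "W \<subseteq> Q \<inter> M" "x \<in> dilate d (convex hull W)" for W
  proof -
    obtain q where q: "q \<in> convex hull W" "x = real d *\<^sub>R q"
      using W(2) by (auto simp: dilate_def)
    obtain U where U: "U \<subseteq> W" "\<not> affine_dependent U" "q \<in> convex hull U"
      using caratheodory_affine_independent[OF q(1)] by blast
    then have "ok U"
      unfolding ok_def dilate_def using W(1) q(2) by blast
    then show ?thesis
      using U(1) by blast
  qed
  have "S \<subseteq> Q \<inter> M"
    using S(2) by (auto simp: Q_def hull_inc)
  then obtain U0 where "ok U0"
    using refine x(2) by blast
  then obtain W where W: "ok W"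
    and min: "\<And>U. ok U \<Longrightarrow> card (convex hull W \<inter> M) \<le> card (convex hull U \<inter> M)"
    using ex_has_least_nat[of ok U0 "\<lambda>U. card (convex hull U \<inter> M)"] by blast
  have WQ: "W \<subseteq> Q \<inter> M" and indep: "\<not> affine_dependent W" and xW: "x \<in> dilate d (convex hull W)"
    using W by (auto simp: ok_def)
  have finW: "finite W"
    using indep by (rule aff_independent_finite)
  have neW: "W \<noteq> {}"
    using xW by (auto simp: dilate_def)
  have dil_sub: "dilate (d - 1) (convex hull W) \<subseteq> dilate (d - 1) Q"
    using WQ by (intro dilate_mono hull_sub) auto
  obtain t where t: "\<And>w. w \<in> W \<Longrightarrow> 0 \<le> t w" and sum_t: "sum t W = real d"
    and x_t: "x = (\<Sum>w\<in>W. t w *\<^sub>R w)"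
    using xW dilate_convex_hull_iff[OF finW neW] by blast
  show ?thesis
  proof (cases "\<exists>w\<in>W. 1 \<le> t w")
    case True
    then obtain w where w: "w \<in> W" "1 \<le> t w"
      by blast
    define t' where "t' v = t v - (if v = w then 1 else 0)" for v
    have "\<forall>v\<in>W. 0 \<le> t' v"
      using w t by (auto simp: t'_def)
    moreover have "sum t' W = real (d - 1)"
      using w finW sum_t d_pos by (simp add: t'_def sum_subtractf of_nat_diff)
    moreover have "x - w = (\<Sum>v\<in>W. t' v *\<^sub>R v)"
    proof -
      have "(\<Sum>v\<in>W. t' v *\<^sub>R v) = (\<Sum>v\<in>W. t v *\<^sub>R v) - (\<Sum>v\<in>W. if v = w then v else 0)"
        unfolding sum_subtractf[symmetric]
        by (intro sum.cong) (auto simp: t'_def scaleR_diff_left)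
      then show ?thesis
        using w(1) finW by (simp add: x_t)
    qed
    ultimately have "x - w \<in> dilate (d - 1) (convex hull W)"
      using dilate_convex_hull_iff[OF finW neW] by blast
    then show ?thesis
      using that[of w] w WQ dil_sub unfolding Q_def by blast
  next
    case False
    then have t1: "\<And>w. w \<in> W \<Longrightarrow> t w < 1"
      by force
    have "real d < real (card W)"
      using sum_strict_mono[OF finW neW, of t "\<lambda>_. 1"] t1 sum_t by simp
    moreover have "card W \<le> DIM('a) + 1"
      using aff_dim_affine_independent[OF indep] aff_dim_le_DIM[of W] by linarith
    ultimately have cardW: "card W = d + 1"
      using d by linarith
    \<comment> \<open>the complement of \<open>x\<close> in the parallelepiped spanned by \<open>W\<close>\<close>
    define h where "h = (\<Sum>w\<in>W. w) - x"
    have h_comb: "h = (\<Sum>w\<in>W. (1 - t w) *\<^sub>R w)"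
      by (simp add: h_def x_t scaleR_diff_left sum_subtractf)
    have sum1: "(\<Sum>w\<in>W. 1 - t w) = 1"
      using cardW sum_t by (simp add: sum_subtractf)
    have hM: "h \<in> M"
      unfolding h_def using WQ x(1) by (intro full_lattice_diff full_lattice_sum M) auto
    have h_hull: "h \<in> convex hull W"
      unfolding h_comb using finW sum1 t1 by (intro convex_sum) (auto simp: hull_inc less_imp_le)
    have h_notin: "h \<notin> W"
    proof
      assume "h \<in> W"
      define u where "u w = (1 - t w) - (if w = h then 1 else 0)" for w
      have "card (W - {h}) \<noteq> 0"
        using cardW d_pos \<open>h \<in> W\<close> by simp
      then obtain w where w: "w \<in> W" "w \<noteq> h"
        by (metis card.empty DiffE all_not_in_conv insertCI)
      have "u w \<noteq> 0"
        using w t1[of w] by (simp add: u_def)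
      moreover have "sum u W = 0"
        using sum1 finW \<open>h \<in> W\<close> by (simp add: u_def sum_subtractf)
      moreover have "(\<Sum>w\<in>W. u w *\<^sub>R w) = 0"
      proof -
        have "(\<Sum>w\<in>W. u w *\<^sub>R w) = (\<Sum>w\<in>W. (1 - t w) *\<^sub>R w) - (\<Sum>w\<in>W. if w = h then w else 0)"
          unfolding sum_subtractf[symmetric]
          by (intro sum.cong) (auto simp: u_def scaleR_diff_left)
        then show ?thesis
          using finW \<open>h \<in> W\<close> by (simp add: h_comb[symmetric])
      qed
      ultimately show False
        using indep w(1) affine_dependent_explicit_finite[OF finW] by blast
    qed
    obtain q where q: "q \<in> convex hull W" "x = real d *\<^sub>R q"
      using xW by (auto simp: dilate_def)
    obtain b where b: "b \<in> W" "q \<in> convex hull (insert h (W - {b}))"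
      using in_convex_hull_exchange[OF h_hull q(1)] .
    define W' where "W' = insert h (W - {b})"
    have "W' \<subseteq> Q \<inter> M"
      using WQ h_hull hM hull_sub[of W] by (auto simp: W'_def)
    moreover have "x \<in> dilate d (convex hull W')"
      using b q(2) by (auto simp: dilate_def W'_def)
    ultimately obtain U where U: "U \<subseteq> W'" "ok U"
      using refine by blast
    have "convex hull W' \<subseteq> convex hull W"
      using h_hull by (intro hull_minimal) (auto simp: W'_def hull_inc)
    then have sub: "convex hull U \<subseteq> convex hull W"
      using U(1) by (meson hull_mono order_trans)
    \<comment> \<open>the discarded vertex is extreme in the larger hull, so the smaller one cannot recover it\<close>
    have "b \<notin> convex hull U"
    proof
      assume bU: "b \<in> convex hull U"
      have "b extreme_point_of convex hull W"
        using b(1) extreme_point_of_convex_hull_affine_independent[OF indep] by blast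
      then have "b extreme_point_of convex hull U"
        using sub bU by (auto simp: extreme_point_of_def)
      then have "b \<in> U"
        by (rule extreme_point_of_convex_hull)
      then show False
        using U(1) b(1) h_notin by (auto simp: W'_def)
    qed
    then have "convex hull U \<inter> M \<subset> convex hull W \<inter> M"
      using sub b(1) WQ hull_inc[of b W] by blast
    moreover have "finite (convex hull W \<inter> M)"
      using finQ hull_sub[of W] WQ by (meson Int_mono finite_subset inf.boundedE subset_refl)
    ultimately have "card (convex hull U \<inter> M) < card (convex hull W \<inter> M)"
      by (simp add: psubset_card_mono)
    then show ?thesis
      using min[OF U(2)] by simp
  qed
qed

section \<open>Lattice points on edges and in corners\<close>

text \<open>
  Parametrise the segment by \<open>[0, 1]\<close>. Parameters of lattice points differ by parameters of
  lattice points, so distinct ones are at least as far apart as the smallest nonzero one, \<open>\<delta>\<close>.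
  Hence there are at most \<open>\<lfloor>1 / \<delta>\<rfloor> + 1\<close> of them, and \<open>\<delta>\<close> is the required step.
\<close>

lemma lattice_step_on_segment:
  fixes M :: "'a::euclidean_space set"
  assumes M: "full_lattice M" and uv: "u \<in> M" "v \<in> M" "u \<noteq> v"
  obtains \<tau> where "0 < \<tau>" "\<tau> * real (segment_lattice_length M u v) \<le> 1" "\<tau> *\<^sub>R (v - u) \<in> M"
proof -
  define T where "T = {t \<in> {0..1}. t *\<^sub>R (v - u) \<in> M}"
  define pt where "pt t = u + t *\<^sub>R (v - u)" for t
  have seg: "closed_segment u v \<inter> M = pt ` T"
  proof (intro equalityI subsetI)
    fix y
    assume "y \<in> closed_segment u v \<inter> M"
    then obtain t where t: "0 \<le> t" "t \<le> 1" "y = pt t" and y: "y \<in> M"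
      by (auto simp: in_segment pt_def algebra_simps)
    have "t *\<^sub>R (v - u) = y - u"
      by (simp add: t pt_def)
    then have "t \<in> T"
      using t(1,2) full_lattice_diff[OF M y uv(1)] by (simp add: T_def)
    then show "y \<in> pt ` T"
      using t(3) by blast
  next
    fix y
    assume "y \<in> pt ` T"
    then obtain t where t: "0 \<le> t" "t \<le> 1" "y = pt t" "t *\<^sub>R (v - u) \<in> M"
      by (auto simp: T_def)
    have "y = (1 - t) *\<^sub>R u + t *\<^sub>R v"
      by (simp add: t(3) pt_def algebra_simps)
    then have "y \<in> closed_segment u v"
      using t(1,2) by (auto simp: in_segment)
    moreover have "y \<in> M"
      using full_lattice_add[OF M uv(1) t(4)] by (simp add: t(3) pt_def)
    ultimately show "y \<in> closed_segment u v \<inter> M"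
      by blast
  qed
  have inj: "inj_on pt T"
    using uv(3) by (auto simp: inj_on_def pt_def)
  have "finite (closed_segment u v \<inter> M)"
    using M compact_segment compact_imp_bounded by (blast intro: full_lattice_finite_bounded)
  then have finT: "finite T"
    using seg inj by (simp add: finite_image_iff)
  have len: "segment_lattice_length M u v = card T - 1"
    by (simp add: segment_lattice_length_def seg card_image inj)
  have T1: "1 \<in> T - {0}"
    using full_lattice_diff[OF M uv(2,1)] by (auto simp: T_def)
  define \<delta> where "\<delta> = Min (T - {0})"
  have "\<delta> \<in> T - {0}"
    unfolding \<delta>_def using finT T1 by (intro Min_in) auto
  then have \<delta>: "0 < \<delta>" "\<delta> *\<^sub>R (v - u) \<in> M"
    by (auto simp: T_def)
  have gap: "t' - t \<ge> \<delta>" if "t \<in> T" "t' \<in> T" "t < t'" for t t'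
  proof -
    have "(t' - t) *\<^sub>R (v - u) \<in> M"
      using full_lattice_diff[OF M, of "t' *\<^sub>R (v - u)" "t *\<^sub>R (v - u)"] that
      by (simp add: T_def scaleR_diff_left)
    then have "t' - t \<in> T - {0}"
      using that by (auto simp: T_def)
    then show ?thesis
      unfolding \<delta>_def using finT by (intro Min_le) auto
  qed
  define k where "k t = nat \<lfloor>t / \<delta>\<rfloor>" for t
  have "k t \<noteq> k t'" if "t \<in> T" "t' \<in> T" "t < t'" for t t'
  proof -
    have "t / \<delta> + 1 \<le> t' / \<delta>"
      using divide_right_mono[OF gap[OF that], of \<delta>] \<delta>(1) by (simp add: diff_divide_distrib)
    then have "\<lfloor>t / \<delta>\<rfloor> + 1 \<le> \<lfloor>t' / \<delta>\<rfloor>"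
      by linarith
    moreover have "0 \<le> \<lfloor>t / \<delta>\<rfloor>"
      using that \<delta>(1) by (simp add: T_def)
    ultimately show ?thesis
      unfolding k_def by linarith
  qed
  then have "inj_on k T"
    by (metis linorder_inj_onI')
  moreover have "k ` T \<subseteq> {..nat \<lfloor>1 / \<delta>\<rfloor>}"
    using \<delta>(1) by (auto simp: k_def T_def intro!: nat_mono floor_mono divide_right_mono)
  ultimately have "card T \<le> nat \<lfloor>1 / \<delta>\<rfloor> + 1"
    using card_inj_on_le[of k T "{..nat \<lfloor>1 / \<delta>\<rfloor>}"] by simp
  then have "real (segment_lattice_length M u v) \<le> real (nat \<lfloor>1 / \<delta>\<rfloor>)"
    unfolding len by simp
  also have "\<dots> \<le> 1 / \<delta>"
    using \<delta>(1) by simp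
  finally have "\<delta> * real (segment_lattice_length M u v) \<le> 1"
    using \<delta>(1) by (simp add: field_simps)
  then show ?thesis
    using that \<delta> by blast
qed

lemma dilate_one [simp]: "dilate (Suc 0) A = A"
  by (simp add: dilate_def)

lemma dilate_hull_insert_0_iff:
  assumes "finite F" "0 \<notin> F"
  shows "x \<in> dilate d (convex hull (insert 0 F)) \<longleftrightarrow>
    (\<exists>t. (\<forall>f\<in>F. 0 \<le> t f) \<and> sum t F \<le> real d \<and> x = (\<Sum>f\<in>F. t f *\<^sub>R f))"
    (is "?L \<longleftrightarrow> ?R")
proof
  assume ?L
  then obtain t where "\<forall>f\<in>insert 0 F. 0 \<le> t f" "sum t (insert 0 F) = real d"
      "x = (\<Sum>f\<in>insert 0 F. t f *\<^sub>R f)"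
    using dilate_convex_hull_iff[of "insert 0 F" x d] assms by blast
  then show ?R
    using assms by (intro exI[of _ t]) auto
next
  assume ?R
  then obtain t where t: "\<forall>f\<in>F. 0 \<le> t f" "sum t F \<le> real d" "x = (\<Sum>f\<in>F. t f *\<^sub>R f)"
    by blast
  define t' where "t' = t(0 := real d - sum t F)"
  have "sum t' F = sum t F" "(\<Sum>f\<in>F. t' f *\<^sub>R f) = x"
    using assms(2) t(3) by (auto simp: t'_def intro!: sum.cong)
  then show ?L
    using dilate_convex_hull_iff[of "insert 0 F" x d] assms t
    by (auto simp: t'_def intro!: exI[of _ t'])
qed

text \<open>
  The walk in the corner of a simplex, with its apex moved to the origin. The vectors \<open>f\<close> are the
  short steps along the edges, \<open>len f *\<^sub>R f\<close> is the whole edge, so that \<open>u f / len f\<close> is a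
  barycentric coordinate; \<open>\<alpha>\<close> stands for the coefficient of the target at the apex. The walk is
  phrased as a maximality argument: among the finitely many admissible lattice points, one of
  largest weight (the sum of these coordinates) satisfies \<open>weight u \<ge> 1 - \<alpha>\<close>. Otherwise the
  remaining coefficients \<open>c - u\<close> have weight above \<open>1\<close>, hence sum above \<open>m\<close>, hence degree at
  least \<open>m + 1\<close> over the simplex spanned by \<open>0\<close> and \<open>F\<close>. A lattice point of that simplex
  can therefore be split off and added, at a gain of weight of at most \<open>1 / m \<le> \<alpha>\<close>.
\<close>

lemma corner_lattice_point:
  fixes M :: "'a::euclidean_space set" and len c :: "'a \<Rightarrow> real"
  assumes M: "full_lattice M"
    and F: "independent F" "F \<subseteq> M"
    and m: "0 < m" "DIM('a) \<le> m + 1"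
    and len: "\<And>f. f \<in> F \<Longrightarrow> real m \<le> len f"
    and c: "\<And>f. f \<in> F \<Longrightarrow> 0 \<le> c f" "(\<Sum>f\<in>F. c f *\<^sub>R f) \<in> M"
    and \<alpha>: "1 / real m \<le> \<alpha>" "2 - \<alpha> \<le> (\<Sum>f\<in>F. c f / len f)"
  obtains u where "\<And>f. f \<in> F \<Longrightarrow> 0 \<le> u f" "\<And>f. f \<in> F \<Longrightarrow> u f \<le> c f"
    "(\<Sum>f\<in>F. u f *\<^sub>R f) \<in> M"
    "1 - \<alpha> \<le> (\<Sum>f\<in>F. u f / len f)" "(\<Sum>f\<in>F. u f / len f) \<le> 1"
proof -
  have finF: "finite F"
    using F(1) by (rule independent_imp_finite)
  have F0: "0 \<notin> F"
    using F(1) dependent_zero by blast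
  have len_pos: "0 < len f" if "f \<in> F" for f
    using len[OF that] m(1) by linarith
  define pt where "pt u = (\<Sum>f\<in>F. u f *\<^sub>R f)" for u :: "'a \<Rightarrow> real"
  define weight where "weight u = (\<Sum>f\<in>F. u f / len f)" for u :: "'a \<Rightarrow> real"
  define ok where "ok u \<longleftrightarrow> (\<forall>f\<in>F. 0 \<le> u f \<and> u f \<le> c f) \<and> pt u \<in> M \<and> weight u \<le> 1"
    for u :: "'a \<Rightarrow> real"
  have pt_coord: "representation F (pt u) f = u f" if "f \<in> F" for u f
    unfolding pt_def using representation_sum_scaleR[OF F(1) that] .
  have pt_add: "pt (\<lambda>f. u f + v f) = pt u + pt v" for u v
    by (simp add: pt_def scaleR_add_left sum.distrib)
  have weight_add: "weight (\<lambda>f. u f + v f) = weight u + weight v" for u v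
    by (simp add: weight_def add_divide_distrib sum.distrib)
  define K where "K = pt ` {u. \<forall>f\<in>F. 0 \<le> u f \<and> u f \<le> c f}"
  have "norm y \<le> (\<Sum>f\<in>F. c f * norm f)" if y: "y \<in> K" for y
  proof -
    obtain u where u: "\<forall>f\<in>F. 0 \<le> u f \<and> u f \<le> c f" "y = pt u"
      using y unfolding K_def by blast
    have "norm y \<le> (\<Sum>f\<in>F. norm (u f *\<^sub>R f))"
      unfolding u(2) pt_def by (rule norm_sum)
    also have "\<dots> \<le> (\<Sum>f\<in>F. c f * norm f)"
      using u(1) by (intro sum_mono) (auto intro!: mult_right_mono)
    finally show ?thesis .
  qed
  then have "bounded K"
    unfolding bounded_iff by blast
  then have "finite (K \<inter> M)"
    by (rule full_lattice_finite_bounded[OF M])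
  moreover have "weight ` Collect ok \<subseteq> (\<lambda>y. weight (representation F y)) ` (K \<inter> M)"
  proof
    fix r
    assume "r \<in> weight ` Collect ok"
    then obtain u where u: "ok u" "r = weight u"
      by blast
    then have "pt u \<in> K \<inter> M"
      by (auto simp: ok_def K_def)
    moreover have "r = weight (representation F (pt u))"
      using u(2) pt_coord by (simp add: weight_def)
    ultimately show "r \<in> (\<lambda>y. weight (representation F y)) ` (K \<inter> M)"
      by blast
  qed
  ultimately have fin: "finite (weight ` Collect ok)"
    by (meson finite_imageI finite_subset)
  have "ok (\<lambda>_. 0)"
    using c(1) full_lattice_zero[OF M] by (auto simp: ok_def pt_def weight_def)
  then have "weight ` Collect ok \<noteq> {}"
    by blast
  then obtain u where u: "ok u" and "weight u = Max (weight ` Collect ok)"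
    using Max_in[OF fin] by (metis imageE mem_Collect_eq)
  then have max: "weight u' \<le> weight u" if "ok u'" for u'
    using Max_ge[OF fin] that by auto
  have "1 - \<alpha> \<le> weight u"
  proof (rule ccontr)
    assume "\<not> 1 - \<alpha> \<le> weight u"
    then have small: "weight u < 1 - \<alpha>"
      by simp
    define c' where "c' f = c f - u f" for f
    have c'0: "0 \<le> c' f" if "f \<in> F" for f
      using u that by (auto simp: ok_def c'_def)
    have cc: "c = (\<lambda>f. u f + c' f)"
      by (auto simp: c'_def)
    define \<sigma> where "\<sigma> = sum c' F"
    have "weight c' > 1"
      using small \<alpha>(2) weight_add[of u c'] unfolding cc[symmetric] by (simp add: weight_def)
    then have "real m < real m * weight c'"
      using m(1) by simp
    also have "\<dots> \<le> \<sigma>"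
      unfolding weight_def \<sigma>_def sum_distrib_left
    proof (rule sum_mono)
      fix f
      assume f: "f \<in> F"
      have "real m * c' f \<le> len f * c' f"
        using len[OF f] c'0[OF f] by (rule mult_right_mono)
      then show "real m * (c' f / len f) \<le> c' f"
        using len_pos[OF f] by (simp add: field_simps)
    qed
    finally have \<sigma>_gt: "real m < \<sigma>" .
    \<comment> \<open>with the least possible degree, the apex \<open>0\<close> cannot be the point that is split off\<close>
    define d where "d = nat \<lceil>\<sigma>\<rceil>"
    have d: "\<sigma> \<le> real d" "real (d - 1) < \<sigma>" "DIM('a) \<le> d"
      using \<sigma>_gt m unfolding d_def by linarith+
    have r: "pt c' \<in> M"
      using full_lattice_diff[OF M, of "pt c" "pt u"] c(2) u pt_add[of u c'] unfolding cc[symmetric]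
      by (simp add: ok_def pt_def)
    have r': "pt c' \<in> dilate d (convex hull (insert 0 F))"
      using dilate_hull_insert_0_iff[OF finF F0] c'0 d(1) unfolding pt_def \<sigma>_def by blast
    obtain h where h: "h \<in> convex hull (insert 0 F)" "h \<in> M"
        "pt c' - h \<in> dilate (d - 1) (convex hull (insert 0 F))"
      by (rule split_off_lattice_point[OF M _ _ r r' d(3)])
        (use finF F(2) full_lattice_zero[OF M] in auto)
    obtain a where a: "\<forall>f\<in>F. 0 \<le> a f" "sum a F \<le> 1" "h = pt a"
      using h(1) dilate_hull_insert_0_iff[OF finF F0, of h "Suc 0"] unfolding pt_def by auto
    obtain b where b: "\<forall>f\<in>F. 0 \<le> b f" "sum b F \<le> real (d - 1)" "pt c' - h = pt b"
      using h(3) dilate_hull_insert_0_iff[OF finF F0] unfolding pt_def by blast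
    have "pt c' = pt (\<lambda>f. a f + b f)"
      using a(3) b(3) by (simp add: pt_add algebra_simps)
    then have ab: "c' f = a f + b f" if "f \<in> F" for f
      using pt_coord[OF that] by metis
    then have "\<sigma> = sum a F + sum b F"
      by (simp add: \<sigma>_def sum.distrib)
    then have "sum a F > 0"
      using b(2) d(2) by linarith
    then obtain f where f: "f \<in> F" "0 < a f"
      by (metis not_le sum_nonpos)
    have "0 < weight a"
      unfolding weight_def using finF f a(1) len_pos
      by (intro sum_pos2[of F f]) (auto simp: less_imp_le)
    have "weight a \<le> (\<Sum>f\<in>F. a f / real m)"
      unfolding weight_def using a(1) len m(1) len_pos by (intro sum_mono divide_left_mono) auto
    also have "\<dots> = sum a F / real m"
      by (simp add: sum_divide_distrib)
    also have "\<dots> \<le> 1 / real m"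
      using a(2) by (simp add: divide_right_mono)
    finally have "weight u + weight a \<le> 1"
      using small \<alpha>(1) by linarith
    moreover have "pt u + pt a \<in> M"
      using full_lattice_add[OF M] h(2) a(3) u by (simp add: ok_def)
    moreover have "0 \<le> u f + a f \<and> u f + a f \<le> c f" if "f \<in> F" for f
      using u a(1) b(1) ab[OF that] that by (auto simp: ok_def c'_def)
    ultimately have "ok (\<lambda>f. u f + a f)"
      by (simp add: ok_def pt_add weight_add)
    then show False
      using max weight_add[of u a] \<open>0 < weight a\<close> by fastforce
  qed
  then show ?thesis
    using u that[of u] unfolding ok_def pt_def weight_def by blast
qed

section \<open>Simplices with long edges\<close>

lemma independent_scaled:
  fixes E :: "'a::euclidean_space set"
  assumes E: "independent E" and \<tau>: "\<And>e. e \<in> E \<Longrightarrow> \<tau> e \<noteq> 0"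
  shows "inj_on (\<lambda>e. \<tau> e *\<^sub>R e) E" "independent ((\<lambda>e. \<tau> e *\<^sub>R e) ` E)"
proof -
  have finE: "finite E"
    using E by (rule independent_imp_finite)
  show inj: "inj_on (\<lambda>e. \<tau> e *\<^sub>R e) E"
  proof (rule inj_onI)
    fix e e'
    assume e: "e \<in> E" "e' \<in> E" "\<tau> e *\<^sub>R e = \<tau> e' *\<^sub>R e'"
    have "representation E (\<tau> e *\<^sub>R e) e = representation E (\<tau> e' *\<^sub>R e') e"
      by (simp add: e(3))
    then show "e = e'"
      using e(1,2) \<tau>[OF e(1)] E
      by (auto simp: representation_scale representation_basis span_base split: if_splits)
  qed
  show "independent ((\<lambda>e. \<tau> e *\<^sub>R e) ` E)"
    unfolding dependent_finite[OF finite_imageI[OF finE]]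
  proof clarify
    fix u e
    assume "(\<Sum>v\<in>(\<lambda>e. \<tau> e *\<^sub>R e) ` E. u v *\<^sub>R v) = 0" and e: "e \<in> E" "u (\<tau> e *\<^sub>R e) \<noteq> 0"
    then have "(\<Sum>e\<in>E. (u (\<tau> e *\<^sub>R e) * \<tau> e) *\<^sub>R e) = 0"
      by (simp add: sum.reindex[OF inj])
    then have "u (\<tau> e *\<^sub>R e) * \<tau> e = 0"
      using independentD[OF E finE subset_refl _ e(1), of "\<lambda>e. u (\<tau> e *\<^sub>R e) * \<tau> e"] by simp
    then show False
      using e \<tau> by simp
  qed
qed

text \<open>
  Averaging over the at most \<open>DIM('a) + 1\<close> vertices gives an apex \<open>p\<close> whose coefficient in \<open>x\<close>
  is at least \<open>1 / (DIM('a) - 1)\<close>, and this is what it takes to apply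
  \<open>corner_lattice_point\<close> to \<open>x - real d *\<^sub>R p\<close>. The bounds \<open>1 - t p\<close> and \<open>1\<close> on the weight say
  that the coefficient of the resulting lattice point at \<open>p\<close> lies between \<open>0\<close> and \<open>t p\<close>.
\<close>

lemma split_off_long_simplex:
  fixes M V :: "'a::euclidean_space set"
  assumes M: "full_lattice M"
    and V: "\<not> affine_dependent V" "V \<subseteq> M"
    and dim: "3 \<le> DIM('a)"
    and long: "\<And>u v. u \<in> V \<Longrightarrow> v \<in> V \<Longrightarrow> u \<noteq> v \<Longrightarrow>
      \<exists>\<tau>>0. \<tau> * real (DIM('a) - 1) \<le> 1 \<and> \<tau> *\<^sub>R (v - u) \<in> M"
    and x: "x \<in> M" "x \<in> dilate d (convex hull V)" and d: "2 \<le> d"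
  obtains h where "h \<in> convex hull V" "h \<in> M" "x - h \<in> dilate (d - 1) (convex hull V)"
proof -
  define m where "m = DIM('a) - 1"
  have finV: "finite V"
    using V(1) by (rule aff_independent_finite)
  have neV: "V \<noteq> {}"
    using x(2) by (auto simp: dilate_def)
  have cardV: "card V \<le> DIM('a) + 1"
    using aff_dim_affine_independent[OF V(1)] aff_dim_le_DIM[of V] by linarith
  obtain t where t: "\<And>v. v \<in> V \<Longrightarrow> 0 \<le> t v" "sum t V = real d" "x = (\<Sum>v\<in>V. t v *\<^sub>R v)"
    using x(2) dilate_convex_hull_iff[OF finV neV] by blast
  obtain p where p: "p \<in> V" "1 / real m \<le> t p"
  proof (rule ccontr)
    assume "\<not> thesis"
    then have "t v < 1 / real m" if "v \<in> V" for v
      using that \<open>\<And>p. p \<in> V \<Longrightarrow> 1 / real m \<le> t p \<Longrightarrow> thesis\<close> not_le by blast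
    then have "sum t V < (\<Sum>v\<in>V. 1 / real m)"
      using finV neV by (intro sum_strict_mono) auto
    also have "\<dots> \<le> real (DIM('a) + 1) / real m"
      using cardV by (simp add: divide_right_mono)
    \<comment> \<open>\<open>(n + 1) / (n - 1) \<le> 2\<close> is where \<open>n \<ge> 3\<close> is needed\<close>
    also have "\<dots> \<le> 2"
      using dim by (simp add: m_def field_simps of_nat_diff)
    finally show False
      using t(2) d by simp
  qed
  define I where "I = V - {p}"
  have finI: "finite I"
    using finV by (simp add: I_def)
  have sumV: "sum w V = w p + sum w I" for w :: "'a \<Rightarrow> real"
    unfolding I_def using p(1) finV by (rule sum.remove[rotated])
  have sumV': "sum w V = w p + sum w I" for w :: "'a \<Rightarrow> 'a"
    unfolding I_def using p(1) finV by (rule sum.remove[rotated])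
  have "\<forall>v\<in>I. \<exists>\<tau>>0. \<tau> * real m \<le> 1 \<and> \<tau> *\<^sub>R (v - p) \<in> M"
    using long[OF p(1)] by (auto simp: I_def m_def)
  then obtain \<tau> where \<tau>: "\<And>v. v \<in> I \<Longrightarrow> 0 < \<tau> v" "\<And>v. v \<in> I \<Longrightarrow> \<tau> v * real m \<le> 1"
      "\<And>v. v \<in> I \<Longrightarrow> \<tau> v *\<^sub>R (v - p) \<in> M"
    by metis
  define g where "g v = \<tau> v *\<^sub>R (v - p)" for v
  define F where "F = g ` I"
  have indep: "independent ((\<lambda>v. v - p) ` I)"
    using V(1) affine_dependent_iff_dependent2[OF p(1)] by (simp add: I_def)
  have F_eq: "F = (\<lambda>e. \<tau> (e + p) *\<^sub>R e) ` (\<lambda>v. v - p) ` I"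
    by (simp add: F_def g_def image_image)
  have indepF: "independent F"
    unfolding F_eq by (rule independent_scaled(2)[OF indep]) (use \<tau>(1) in force)
  have "inj_on ((\<lambda>e. \<tau> (e + p) *\<^sub>R e) \<circ> (\<lambda>v. v - p)) I"
    by (intro comp_inj_on independent_scaled(1)[OF indep]) (use \<tau>(1) in \<open>force simp: inj_on_def\<close>)+
  then have inj: "inj_on g I"
    by (simp add: g_def[abs_def] o_def)
  define w where "w = inv_into I g"
  have w: "w (g v) = v" if "v \<in> I" for v
    using inj that by (simp add: w_def)
  define len where "len f = 1 / \<tau> (w f)" for f
  define c where "c f = t (w f) / \<tau> (w f)" for f
  have sumF: "(\<Sum>f\<in>F. y f) = (\<Sum>v\<in>I. y (g v))" for y :: "'a \<Rightarrow> real"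
    unfolding F_def using inj by (simp add: sum.reindex)
  have sumF': "(\<Sum>f\<in>F. y f) = (\<Sum>v\<in>I. y (g v))" for y :: "'a \<Rightarrow> 'a"
    unfolding F_def using inj by (simp add: sum.reindex)
  have "(\<Sum>f\<in>F. c f *\<^sub>R f) = (\<Sum>v\<in>I. t v *\<^sub>R (v - p))"
    unfolding sumF'
  proof (rule sum.cong[OF refl])
    fix v assume "v \<in> I"
    then show "c (g v) *\<^sub>R g v = t v *\<^sub>R (v - p)"
      using \<tau>(1)[of v] w[of v] by (simp add: c_def g_def)
  qed
  also have "\<dots> = x - real d *\<^sub>R p"
    using t(2) unfolding t(3) sumV sumV'
    by (simp add: algebra_simps scaleR_sum_left[symmetric] sum_subtractf flip: scaleR_add_left)
  finally have cF: "(\<Sum>f\<in>F. c f *\<^sub>R f) = x - real d *\<^sub>R p" .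
  have "real d *\<^sub>R p \<in> M"
    using full_lattice_sum[OF M, of "{..<d}" "\<lambda>_. p"] p(1) V(2)
    by (auto simp: sum_constant_scaleR)
  then have cM: "(\<Sum>f\<in>F. c f *\<^sub>R f) \<in> M"
    unfolding cF using M x(1) by (intro full_lattice_diff)
  have "(\<Sum>f\<in>F. c f / len f) = (\<Sum>v\<in>I. t v)"
    unfolding sumF
  proof (rule sum.cong[OF refl])
    fix v assume "v \<in> I"
    then show "c (g v) / len (g v) = t v"
      using \<tau>(1)[of v] w[of v] by (simp add: c_def len_def)
  qed
  then have c_large: "2 - t p \<le> (\<Sum>f\<in>F. c f / len f)"
    using t(2) d sumV[of t] by simp
  have FM: "F \<subseteq> M"
    using \<tau>(3) by (auto simp: F_def g_def)
  have m: "0 < m" "DIM('a) \<le> m + 1"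
    using dim by (auto simp: m_def)
  have len: "real m \<le> len f" if f: "f \<in> F" for f
    using f \<tau>(1,2) w by (auto simp: F_def len_def field_simps)
  have c0: "0 \<le> c f" if f: "f \<in> F" for f
  proof -
    obtain v where "v \<in> I" "f = g v"
      using f by (auto simp: F_def)
    then show ?thesis
      using \<tau>(1)[of v] w[of v] t(1)[of v] by (simp add: c_def I_def)
  qed
  obtain u where u: "\<And>f. f \<in> F \<Longrightarrow> 0 \<le> u f" "\<And>f. f \<in> F \<Longrightarrow> u f \<le> c f"
    "(\<Sum>f\<in>F. u f *\<^sub>R f) \<in> M"
    "1 - t p \<le> (\<Sum>f\<in>F. u f / len f)" "(\<Sum>f\<in>F. u f / len f) \<le> 1"
    using corner_lattice_point[OF M indepF FM m len c0 cM p(2) c_large] by blast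
  define s where "s v = u (g v) * \<tau> v" for v
  have s: "0 \<le> s v" "s v \<le> t v" if v: "v \<in> I" for v
  proof -
    have "g v \<in> F"
      using v by (simp add: F_def)
    then show "0 \<le> s v" "s v \<le> t v"
      using u(1,2)[of "g v"] \<tau>(1)[OF v] w[OF v] by (auto simp: s_def c_def field_simps)
  qed
  have sum_s: "(\<Sum>f\<in>F. u f / len f) = sum s I"
    unfolding sumF using w by (intro sum.cong) (auto simp: len_def s_def)
  define b where "b v = (if v = p then 1 - sum s I else s v)" for v
  have bI: "b v = s v" if "v \<in> I" for v
    using that by (auto simp: b_def I_def)
  have b: "0 \<le> b v" "b v \<le> t v" if "v \<in> V" for v
    using that s u(4,5) sum_s by (auto simp: b_def I_def)
  have sum_b: "sum b V = 1"
    unfolding sumV using bI by (simp add: b_def[of p])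
  define h where "h = (\<Sum>v\<in>V. b v *\<^sub>R v)"
  have "h = p + (\<Sum>v\<in>I. s v *\<^sub>R (v - p))"
    unfolding h_def sumV' using bI
    by (simp add: b_def[of p] algebra_simps sum_subtractf scaleR_sum_left)
  also have "(\<Sum>v\<in>I. s v *\<^sub>R (v - p)) = (\<Sum>f\<in>F. u f *\<^sub>R f)"
    unfolding sumF' by (simp add: s_def g_def)
  finally have "h \<in> M"
    using full_lattice_add[OF M] p(1) V(2) u(3) by auto
  moreover have "h \<in> convex hull V"
    unfolding h_def using finV sum_b b(1) by (intro convex_sum) (auto simp: hull_inc)
  moreover have "x - h \<in> dilate (d - 1) (convex hull V)"
    unfolding dilate_convex_hull_iff[OF finV neV]
    using b(2) t(2) sum_b d
    by (intro exI[of _ "\<lambda>v. t v - b v"])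
      (auto simp: h_def t(3) sum_subtractf scaleR_diff_left of_nat_diff)
  ultimately show ?thesis
    using that by blast
qed

theorem theorem1p3:
  fixes M P :: "'a::euclidean_space set"
  assumes "full_lattice M"
    and "lattice_simplex M P"
    and "lattice_length M P \<ge> DIM('a) - 1"
  shows "integrally_closed M P"
proof -
  note M = assms(1)
  define V where "V = vertices P"
  obtain S where S: "finite S" "S \<subseteq> M" "P = convex hull S" and dimP: "aff_dim P = int DIM('a)"
    and cardV: "card V = DIM('a) + 1"
    using assms(2) by (auto simp: lattice_simplex_def lattice_polytope_def V_def)
  have VS: "V \<subseteq> S"
    unfolding V_def vertices_def S(3) by (rule extreme_points_of_convex_hull)
  then have V: "finite V" "V \<subseteq> M"
    using S by (auto intro: finite_subset)
  have P: "P = convex hull V"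
    unfolding V_def vertices_def S(3) using Krein_Milman_polytope[OF S(1)] .
  have "aff_dim V = int (card V) - 1"
    using dimP cardV by (simp add: P aff_dim_convex_hull)
  then have indep: "\<not> affine_dependent V"
    using V(1) by (simp add: affine_independent_iff_card)
  have edge_long: "DIM('a) - 1 \<le> segment_lattice_length M u v"
    if uv: "u \<in> V" "v \<in> V" "u \<noteq> v" for u v
  proof -
    define L where "L = {segment_lattice_length M u v | u v.
        u \<in> vertices P \<and> v \<in> vertices P \<and> u \<noteq> v \<and> closed_segment u v edge_of P}"
    have "L \<subseteq> (\<lambda>(u, v). segment_lattice_length M u v) ` (V \<times> V)"
      by (auto simp: L_def V_def)
    then have "finite L"
      using V(1) by (meson finite_SigmaI finite_imageI finite_subset)
    moreover have "closed_segment u v edge_of P"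
      unfolding edge_of_def P segment_convex_hull face_of_convex_hull_affine_independent[OF indep]
      using uv by (auto simp: aff_dim_convex_hull intro!: exI[of _ "{u, v}"])
    then have "segment_lattice_length M u v \<in> L"
      using uv by (auto simp: L_def V_def)
    ultimately have "Min L \<le> segment_lattice_length M u v"
      by simp
    then show ?thesis
      using assms(3) by (simp add: lattice_length_def L_def)
  qed
  have long: "\<exists>\<tau>>0. \<tau> * real (DIM('a) - 1) \<le> 1 \<and> \<tau> *\<^sub>R (v - u) \<in> M"
    if uv: "u \<in> V" "v \<in> V" "u \<noteq> v" for u v
  proof -
    obtain \<tau> where \<tau>: "0 < \<tau>" "\<tau> * real (segment_lattice_length M u v) \<le> 1" "\<tau> *\<^sub>R (v - u) \<in> M"
      using lattice_step_on_segment[OF M _ _ uv(3)] uv(1,2) V(2) by blast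
    have "\<tau> * real (DIM('a) - 1) \<le> \<tau> * real (segment_lattice_length M u v)"
      using \<tau>(1) edge_long[OF uv] by (intro mult_left_mono) auto
    also have "\<dots> \<le> 1"
      by (rule \<tau>(2))
    finally show ?thesis
      using \<tau>(1,3) by blast
  qed
  have split: "\<exists>h\<in>P \<inter> M. x - h \<in> dilate r P"
    if r: "1 \<le> r" and x: "x \<in> dilate (r + 1) P" "x \<in> M" for r x
  proof (cases "3 \<le> DIM('a)")
    case True
    then show ?thesis
      using split_off_long_simplex[OF M indep V(2) True long x(2), of "r + 1"] x(1) r
      unfolding P by auto
  next
    case False
    then show ?thesis
      using split_off_lattice_point[OF M V x(2), of "r + 1"] x(1) r unfolding P by auto
  qed
  show ?thesis
    unfolding integrally_closed_def
  proof (intro allI impI equalityI subsetI)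
    fix r :: nat and x
    assume "1 \<le> r" "x \<in> dilate (r + 1) P \<inter> M"
    then obtain h where h: "h \<in> P \<inter> M" "x - h \<in> dilate r P"
      using split by blast
    moreover have "x - h \<in> M"
      using full_lattice_diff[OF M] h \<open>x \<in> _\<close> by blast
    ultimately show "x \<in> P \<inter> M + dilate r P \<inter> M"
      using set_plus_intro[of h "P \<inter> M" "x - h" "dilate r P \<inter> M"] by simp
  next
    fix r :: nat and x
    assume "x \<in> P \<inter> M + dilate r P \<inter> M"
    then obtain y z where "y \<in> P \<inter> M" "z \<in> dilate r P \<inter> M" "x = y + z"
      by (rule set_plus_elim)
    then show "x \<in> dilate (r + 1) P \<inter> M"
      using dilate_add_convex[of P y z r] full_lattice_add[OF M] by (auto simp: P)
  qed
qed

end
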